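(* There exists an infinite, three-generated, $2$-modular lattice $K$ with zero such that $K\otimes K$ is a capped tensor product.
   Context: For a lattice $L$, define $\langle x,y,z\rangle^{(1)}=\langle x\vee(y\wedge z),y\vee(x\wedge z),z\vee(x\wedge y)\rangle$ on $L^3$, $u^{(0)}=u$, $u^{(k+1)}=(u^{(k)})^{(1)}$; $L$ is $2$-modular if $u^{(3)}=u^{(2)}$ for all $u\in L^3$. Tensor products: for join-semilattices with zero $A,B$, a bi-ideal of $A\times B$ is a down-set containing $(A\times\{0\})\cup(\{0\}\times B)$ and closed under lateral joins (joins of pairs $\langle a_0,b_0\rangle,\langle a_1,b_1\rangle$ with $a_0=a_1$ or $b_0=b_1$); $A\otimes B$ is the join-semilattice of compact elements of the algebraic lattice of all bi-ideals of $A\times B$. A bi-ideal $I$ is capped if there is a finite $\Gamma\subseteq A\times B$ such that $I$ is the down-set generated by $\Gamma\cup(A\times\{0\})\cup(\{0\}\times B)$; $A\otimes B$ is a capped tensor product if all its elements are capped. *)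

theory Defs
  imports Main
begin

definition lattice_on :: "'a set \<Rightarrow> ('a \<Rightarrow> 'a \<Rightarrow> 'a) \<Rightarrow> ('a \<Rightarrow> 'a \<Rightarrow> 'a) \<Rightarrow> bool" where
  "lattice_on K j m \<longleftrightarrow>
     (\<forall>x\<in>K. \<forall>y\<in>K. j x y \<in> K \<and> m x y \<in> K) \<and>
     (\<forall>x\<in>K. \<forall>y\<in>K. j x y = j y x \<and> m x y = m y x) \<and>
     (\<forall>x\<in>K. \<forall>y\<in>K. \<forall>z\<in>K. j (j x y) z = j x (j y z) \<and> m (m x y) z = m x (m y z)) \<and>
     (\<forall>x\<in>K. j x x = x \<and> m x x = x) \<and>
     (\<forall>x\<in>K. \<forall>y\<in>K. j x (m x y) = x \<and> m x (j x y) = x)"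

definition is_zero :: "'a set \<Rightarrow> ('a \<Rightarrow> 'a \<Rightarrow> 'a) \<Rightarrow> 'a \<Rightarrow> bool" where
  "is_zero K j z \<longleftrightarrow> z \<in> K \<and> (\<forall>x\<in>K. j z x = x)"

definition lat_gen :: "('a \<Rightarrow> 'a \<Rightarrow> 'a) \<Rightarrow> ('a \<Rightarrow> 'a \<Rightarrow> 'a) \<Rightarrow> 'a set \<Rightarrow> 'a set" where
  "lat_gen j m G = \<Inter>{S. G \<subseteq> S \<and> (\<forall>x\<in>S. \<forall>y\<in>S. j x y \<in> S \<and> m x y \<in> S)}"

definition three_generated :: "'a set \<Rightarrow> ('a \<Rightarrow> 'a \<Rightarrow> 'a) \<Rightarrow> ('a \<Rightarrow> 'a \<Rightarrow> 'a) \<Rightarrow> bool" where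
  "three_generated K j m \<longleftrightarrow> (\<exists>a\<in>K. \<exists>b\<in>K. \<exists>c\<in>K. K = lat_gen j m {a, b, c})"

definition step1 :: "('a \<Rightarrow> 'a \<Rightarrow> 'a) \<Rightarrow> ('a \<Rightarrow> 'a \<Rightarrow> 'a) \<Rightarrow> 'a \<times> 'a \<times> 'a \<Rightarrow> 'a \<times> 'a \<times> 'a" where
  "step1 j m u = (case u of (x, y, z) \<Rightarrow> (j x (m y z), j y (m x z), j z (m x y)))"

definition two_modular :: "'a set \<Rightarrow> ('a \<Rightarrow> 'a \<Rightarrow> 'a) \<Rightarrow> ('a \<Rightarrow> 'a \<Rightarrow> 'a) \<Rightarrow> bool" where
  "two_modular K j m \<longleftrightarrow>
     (\<forall>x\<in>K. \<forall>y\<in>K. \<forall>z\<in>K. (step1 j m ^^ 3) (x, y, z) = (step1 j m ^^ 2) (x, y, z))"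

text \<open>A join-semilattice with zero is given by carrier A, join ja, zero za; order a \<le> a' iff ja a a' = a'.\<close>

definition bi_ideal ::
  "'a set \<Rightarrow> ('a \<Rightarrow> 'a \<Rightarrow> 'a) \<Rightarrow> 'a \<Rightarrow> 'b set \<Rightarrow> ('b \<Rightarrow> 'b \<Rightarrow> 'b) \<Rightarrow> 'b \<Rightarrow> ('a \<times> 'b) set \<Rightarrow> bool" where
  "bi_ideal A ja za B jb zb I \<longleftrightarrow>
     I \<subseteq> A \<times> B \<and>
     (\<forall>a b a' b'. (a, b) \<in> I \<and> a' \<in> A \<and> b' \<in> B \<and> ja a' a = a \<and> jb b' b = b \<longrightarrow> (a', b') \<in> I) \<and>
     (A \<times> {zb}) \<union> ({za} \<times> B) \<subseteq> I \<and>
     (\<forall>a b0 b1. (a, b0) \<in> I \<and> (a, b1) \<in> I \<longrightarrow> (a, jb b0 b1) \<in> I) \<and>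
     (\<forall>a0 a1 b. (a0, b) \<in> I \<and> (a1, b) \<in> I \<longrightarrow> (ja a0 a1, b) \<in> I)"

definition bi_gen ::
  "'a set \<Rightarrow> ('a \<Rightarrow> 'a \<Rightarrow> 'a) \<Rightarrow> 'a \<Rightarrow> 'b set \<Rightarrow> ('b \<Rightarrow> 'b \<Rightarrow> 'b) \<Rightarrow> 'b \<Rightarrow> ('a \<times> 'b) set \<Rightarrow> ('a \<times> 'b) set" where
  "bi_gen A ja za B jb zb X = \<Inter>{J. bi_ideal A ja za B jb zb J \<and> X \<subseteq> J}"

text \<open>Compact elements of the lattice of bi-ideals (= elements of A \<otimes> B).\<close>
definition compact_bi_ideal ::
  "'a set \<Rightarrow> ('a \<Rightarrow> 'a \<Rightarrow> 'a) \<Rightarrow> 'a \<Rightarrow> 'b set \<Rightarrow> ('b \<Rightarrow> 'b \<Rightarrow> 'b) \<Rightarrow> 'b \<Rightarrow> ('a \<times> 'b) set \<Rightarrow> bool" where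
  "compact_bi_ideal A ja za B jb zb I \<longleftrightarrow>
     bi_ideal A ja za B jb zb I \<and>
     (\<forall>S. (\<forall>J\<in>S. bi_ideal A ja za B jb zb J) \<and> I \<subseteq> bi_gen A ja za B jb zb (\<Union>S) \<longrightarrow>
          (\<exists>F\<subseteq>S. finite F \<and> I \<subseteq> bi_gen A ja za B jb zb (\<Union>F)))"

definition capped ::
  "'a set \<Rightarrow> ('a \<Rightarrow> 'a \<Rightarrow> 'a) \<Rightarrow> 'a \<Rightarrow> 'b set \<Rightarrow> ('b \<Rightarrow> 'b \<Rightarrow> 'b) \<Rightarrow> 'b \<Rightarrow> ('a \<times> 'b) set \<Rightarrow> bool" where
  "capped A ja za B jb zb I \<longleftrightarrow>
     (\<exists>\<Gamma>. finite \<Gamma> \<and> \<Gamma> \<subseteq> A \<times> B \<and>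
        I = {(a', b'). a' \<in> A \<and> b' \<in> B \<and>
               (\<exists>(a, b)\<in>\<Gamma> \<union> (A \<times> {zb}) \<union> ({za} \<times> B). ja a' a = a \<and> jb b' b = b)})"

definition capped_tensor_product ::
  "'a set \<Rightarrow> ('a \<Rightarrow> 'a \<Rightarrow> 'a) \<Rightarrow> 'a \<Rightarrow> 'b set \<Rightarrow> ('b \<Rightarrow> 'b \<Rightarrow> 'b) \<Rightarrow> 'b \<Rightarrow> bool" where
  "capped_tensor_product A ja za B jb zb \<longleftrightarrow>
     (\<forall>I. compact_bi_ideal A ja za B jb zb I \<longrightarrow> capped A ja za B jb zb I)"

end

theory Submission
  imports Defs "HOL-Library.Extended_Nat"
begin

text \<open>
  If the order of \<open>K\<close> is dually a well-quasi-order, then so is that of \<open>K \<times> K\<close>, and every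
  down-set of \<open>K \<times> K\<close> is a finite union of principal ones: all bi-ideals are capped. So an infinite
  three-generated 2-modular lattice of this kind is enough. Take three descending chains of type
  \<open>\<omega> + 1\<close>; a down-set of their disjoint union is a triple \<open>t\<close> of extended naturals (where the
  down-set starts in each chain), and a larger triple is a smaller down-set. Keep the triples in
  which every entry is at most the successor of the maximum of the other two. The three chain tops
  generate everything, since the top of one chain joined with the \<open>n\<close>-th element of another contains
  exactly the elements from number \<open>n + 1\<close> on of the third.

  For 2-modularity, one step replaces each entry of a triple of lattice elements by its join with
  the closure \<open>M\<close> of their median \<open>(x \<and> y) \<or> (y \<and> z) \<or> (x \<and> z)\<close>. The closure lowers at most one
  coordinate, strictly only when it exceeds the other two, and comparing the coordinates shows that
  the median no longer changes after the second step.
\<close>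

type_synonym ix = Enum.finite_3
type_synonym trip = "ix \<Rightarrow> enat"

subsection \<open>The lattice of closed triples\<close>

text \<open>Lowering an entry enlarges the down-set, so in the reversed order this is a closure
  operator. All three bounds are read off the original \<open>t\<close>; one simultaneous cut
  suffices by \<open>cl_cl\<close>.\<close>

definition cl :: "trip \<Rightarrow> trip" where
  "cl t = (\<lambda>i. min (t i) (eSuc (Max (t ` (- {i})))))"

definition pmin :: "trip \<Rightarrow> trip \<Rightarrow> trip" where
  "pmin s t = (\<lambda>i. min (s i) (t i))"

definition pmax :: "trip \<Rightarrow> trip \<Rightarrow> trip" where
  "pmax s t = (\<lambda>i. max (s i) (t i))"

definition cjoin :: "trip \<Rightarrow> trip \<Rightarrow> trip" where
  "cjoin s t = cl (pmin s t)"

definition Clo :: "trip set" where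
  "Clo = {t. cl t = t}"

lemma third: "i \<noteq> j \<Longrightarrow> \<exists>k::ix. distinct [i, j, k]"
  by (cases i; cases j) (auto intro: exI[of _ finite_3.a\<^sub>1] exI[of _ finite_3.a\<^sub>2] exI[of _ finite_3.a\<^sub>3])

lemma others: "\<exists>j k::ix. distinct [i, j, k]"
  by (metis third finite_3.distinct(1) finite_3.distinct(3))

lemma compl_ix: "distinct [i, j, k] \<Longrightarrow> - {i} = {j, k :: ix}"
  by (cases i; cases j; cases k) (auto simp: UNIV_finite_3 Compl_eq_Diff_UNIV)

lemma cl_eq: "distinct [i, j, k] \<Longrightarrow> cl t i = min (t i) (eSuc (max (t j) (t k)))"
  by (simp only: cl_def compl_ix) simp

lemma eSuc_max: "eSuc (max x y) = max (eSuc x) (eSuc y)"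
  by (simp add: max_def)

lemma le_eSuc: "x \<le> y \<Longrightarrow> x \<le> eSuc y" for x y :: enat
  by (meson ile_eSuc order_trans)

lemma cl_le: "cl t i \<le> t i"
  by (simp add: cl_def)

lemma cl_mono:
  assumes "\<And>i. s i \<le> t i"
  shows "cl s i \<le> cl t i"
proof -
  obtain j k where d: "distinct [i, j, k]" using others[of i] by blast
  have "eSuc (max (s j) (s k)) \<le> eSuc (max (t j) (t k))"
    by (simp only: eSuc_ile_mono) (intro max.mono assms)
  then show ?thesis using assms unfolding cl_eq[OF d] by (intro min.mono)
qed

lemma cl_shrink:
  assumes "distinct [i, j, k]" "cl t i < t i"
  shows "t j \<le> cl t i" "t k \<le> cl t i"
  using assms by (auto simp: cl_eq min_def intro: le_eSuc split: if_splits)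

text \<open>A lowered entry still dominates the two others, so the bound it provides for them
  survives; if neither \<open>j\<close> nor \<open>k\<close> is lowered, the bound for
  \<open>i\<close> is unchanged.\<close>

lemma cl_cl: "cl (cl t) = cl t"
proof
  fix i :: ix
  obtain j k where d: "distinct [i, j, k]" using others[of i] by blast
  then have d': "distinct [j, i, k]" "distinct [k, i, j]" by auto
  have "cl t i \<le> eSuc (max (cl t j) (cl t k))"
  proof (cases "cl t j < t j \<or> cl t k < t k")
    case True
    then have "t i \<le> max (cl t j) (cl t k)"
      using cl_shrink(1)[OF d'(1)] cl_shrink(1)[OF d'(2)] by (auto simp: le_max_iff_disj)
    then show ?thesis using cl_le[of t i] by (meson le_eSuc order_trans)
  next
    case False
    then have "cl t j = t j" "cl t k = t k" using cl_le by (auto simp: order.antisym not_less)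
    then show ?thesis using d by (simp add: cl_eq)
  qed
  then show "cl (cl t) i = cl t i" using cl_eq[OF d, of "cl t"] by (simp add: min_def)
qed

lemma cl_Clo [simp]: "cl t \<in> Clo"
  by (simp add: Clo_def cl_cl)

lemma CloD: "t \<in> Clo \<Longrightarrow> distinct [i, j, k] \<Longrightarrow> t i \<le> eSuc (max (t j) (t k))"
  unfolding Clo_def by (metis (mono_tags) cl_eq mem_Collect_eq min.cobounded2)

lemma CloI:
  assumes "\<And>i j k. distinct [i, j, k] \<Longrightarrow> t i \<le> eSuc (max (t j) (t k))"
  shows "t \<in> Clo"
proof -
  have "cl t i = t i" for i
    using others[of i] assms[of i] cl_eq[of i] by (metis min.absorb1)
  then show ?thesis by (auto simp: Clo_def)
qed

lemma le_cl:
  assumes "s \<in> Clo" "\<And>i. s i \<le> t i"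
  shows "s i \<le> cl t i"
  using cl_mono[of s t i] assms by (simp add: Clo_def)

text \<open>Both sides are the largest closed triple below \<open>s\<close> and \<open>t\<close>.
  This yields associativity of \<open>cjoin\<close>.\<close>

lemma cl_pmin_cl: "cl (pmin (cl s) t) = cl (pmin s t)"
proof
  fix i
  have "cl (pmin s t) i \<le> pmin (cl s) t i" for i
    using cl_mono[of "pmin s t" s i] cl_le[of "pmin s t" i] by (auto simp: pmin_def)
  then have "cl (pmin s t) i \<le> cl (pmin (cl s) t) i"
    by (intro le_cl) auto
  moreover have "cl (pmin (cl s) t) i \<le> cl (pmin s t) i"
    by (rule cl_mono) (auto simp: pmin_def cl_le intro: min.coboundedI1)
  ultimately show "cl (pmin (cl s) t) i = cl (pmin s t) i" by simp
qed

lemma pmin_commute: "pmin s t = pmin t s"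
  by (simp add: pmin_def min.commute)

lemma cl_pmin_cl2: "cl (pmin s (cl t)) = cl (pmin s t)"
  by (metis cl_pmin_cl pmin_commute)

lemma pmax_Clo:
  assumes "s \<in> Clo" "t \<in> Clo"
  shows "pmax s t \<in> Clo"
proof (rule CloI)
  fix i j k :: ix
  assume d: "distinct [i, j, k]"
  have "s i \<le> eSuc (max (pmax s t j) (pmax s t k))"
    by (rule order_trans[OF CloD[OF assms(1) d]]) (auto simp: pmax_def le_max_iff_disj)
  moreover have "t i \<le> eSuc (max (pmax s t j) (pmax s t k))"
    by (rule order_trans[OF CloD[OF assms(2) d]]) (auto simp: pmax_def le_max_iff_disj)
  ultimately show "pmax s t i \<le> eSuc (max (pmax s t j) (pmax s t k))"
    by (simp add: pmax_def)
qed

text \<open>The order is reversed: the meet is the pointwise maximum.\<close>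

lemma lattice_Clo: "lattice_on Clo cjoin pmax"
  unfolding lattice_on_def
proof (intro conjI ballI)
  fix x y z assume x: "x \<in> Clo" and y: "y \<in> Clo" and z: "z \<in> Clo"
  show "cjoin x y \<in> Clo" by (simp add: cjoin_def)
  show "pmax x y \<in> Clo" using x y by (rule pmax_Clo)
  show "cjoin x y = cjoin y x" by (simp add: cjoin_def pmin_commute)
  show "pmax x y = pmax y x" by (simp add: pmax_def max.commute)
  show "cjoin (cjoin x y) z = cjoin x (cjoin y z)"
    by (simp add: cjoin_def cl_pmin_cl cl_pmin_cl2) (simp add: pmin_def min.assoc)
  show "pmax (pmax x y) z = pmax x (pmax y z)" by (simp add: pmax_def max.assoc)
  show "cjoin x x = x" using x by (simp add: cjoin_def pmin_def Clo_def)
  show "pmax x x = x" by (simp add: pmax_def)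
  show "cjoin x (pmax x y) = x" using x by (simp add: cjoin_def pmin_def pmax_def Clo_def)
  show "pmax x (cjoin x y) = x"
    using cl_le[of "pmin x y"] by (auto simp: cjoin_def pmin_def pmax_def max_def fun_eq_iff order.antisym)
qed

subsection \<open>2-modularity\<close>

text \<open>The type \<open>ix\<close> numbers both the elements of a triple in the lattice and the
  chains: \<open>u p i\<close> is coordinate \<open>i\<close> of element \<open>p\<close>. The
  median is taken coordinatewise and is self-dual, so reversing the order does not affect its
  formula.\<close>

definition med :: "(ix \<Rightarrow> trip) \<Rightarrow> trip" where
  "med u = pmax (pmin (u finite_3.a\<^sub>1) (u finite_3.a\<^sub>2))
     (pmax (pmin (u finite_3.a\<^sub>1) (u finite_3.a\<^sub>3)) (pmin (u finite_3.a\<^sub>2) (u finite_3.a\<^sub>3)))"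

definition mstep :: "(ix \<Rightarrow> trip) \<Rightarrow> ix \<Rightarrow> trip" where
  "mstep u = (\<lambda>p. cl (pmin (u p) (med u)))"

lemma med_le: "p \<noteq> q \<Longrightarrow> med u i \<le> max (u p i) (u q i)"
  by (cases p; cases q) (auto simp: med_def pmin_def pmax_def min_def max_def)

lemma le_med: "p \<noteq> q \<Longrightarrow> min (u p i) (u q i) \<le> med u i"
  by (cases p; cases q) (auto simp: med_def pmin_def pmax_def min_def max_def)

lemma med_cases: "\<exists>p q. p \<noteq> q \<and> u p i \<le> med u i \<and> u q i \<le> med u i"
proof (rule ccontr)
  assume "\<not> ?thesis"
  then have "med u i < u finite_3.a\<^sub>1 i \<and> med u i < u finite_3.a\<^sub>2 i \<or>
     med u i < u finite_3.a\<^sub>1 i \<and> med u i < u finite_3.a\<^sub>3 i \<or>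
     med u i < u finite_3.a\<^sub>2 i \<and> med u i < u finite_3.a\<^sub>3 i"
    by (metis finite_3.distinct(1,3,5) not_le)
  then show False
    by (auto simp: med_def pmin_def pmax_def min_less_iff_disj)
qed

lemma mstep_conv: "mstep u p = cl (pmin (u p) (cl (med u)))"
  by (simp add: mstep_def cl_pmin_cl2)

text \<open>
  The only way in which the second step could still lower coordinate \<open>i\<close> of the median \<open>B\<close>: it is
  lowered in \<open>v p\<close>, whose coordinate \<open>j\<close> is cut down to \<open>B j\<close>, while \<open>v q i\<close> was too small already.
  Then \<open>v q j\<close> must have been lowered in the first step, although \<open>v q k\<close> is larger.
\<close>

lemma two_modular_core:
  fixes u :: "ix \<Rightarrow> trip"
  defines "A \<equiv> cl (med u)" and "v \<equiv> mstep u"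
  defines "B \<equiv> cl (med v)" and "w \<equiv> mstep v"
  assumes d: "distinct [i, j, k]" and e: "distinct [p, q, r]"
    and wp: "w p i < B i" and vp: "B i \<le> v p i" and vq: "v q i < B i" and pj: "B j < v p j"
  shows False
proof -
  have dj: "distinct [j, i, k]" using d by auto
  have B: "B \<in> Clo" by (simp add: B_def)
  have two_v: "B l \<le> max (v a l) (v b l)" if "a \<noteq> b" for a b l
    using cl_le[of "med v" l] med_le[OF that, of v l] by (simp add: B_def)
  have two_u: "A l \<le> max (u a l) (u b l)" if "a \<noteq> b" for a b l
    using cl_le[of "med u" l] med_le[OF that, of u l] by (simp add: A_def)
  have v: "v a = cl (pmin (u a) A)" for a by (simp add: v_def A_def mstep_conv)
  have w: "w a = cl (pmin (v a) B)" for a by (simp add: w_def B_def mstep_conv)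
  \<comment> \<open>Before closure the entry at \<open>i\<close> is \<open>B i\<close>, so
    \<open>w p i\<close> is the cut value.\<close>
  have sh: "eSuc (max (min (v p j) (B j)) (min (v p k) (B k))) < B i"
    using wp vp unfolding w cl_eq[OF d] by (auto simp: pmin_def min_def split: if_splits)
  have s1: "eSuc (B j) < B i" and s2: "eSuc (min (v p k) (B k)) < B i"
    using sh pj by (simp_all add: eSuc_max min_absorb2)
  have Bi: "B i \<le> eSuc (max (B j) (B k))" using CloD[OF B d] .
  have jk: "B j < B k" using Bi s1 by (metis leD max_absorb1 not_less)
  have Bi': "B i \<le> eSuc (B k)" using Bi jk by (simp add: max_absorb2)
  have pk: "v p k < B k" using s2 Bi' by (metis leD min_absorb2 not_less)
  have qk: "B k \<le> v q k" using two_v[of p q k] pk e by (auto simp: le_max_iff_disj)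
  \<comment> \<open>A cut at \<open>j\<close> would leave \<open>B j\<close> at least
    \<open>med v k\<close>, hence at least \<open>B k\<close>.\<close>
  have "B j = med v j"
    using cl_shrink(2)[OF dj, of "med v"] cl_le[of "med v" j] cl_le[of "med v" k] jk
    unfolding B_def by (meson leD order.strict_trans1 order.trans order.not_eq_order_implies_strict)
  then have qj: "v q j \<le> B j" and rj: "v r j \<le> B j"
    using le_med[of p q v j] le_med[of p r v j] pj e by (auto simp: min_def split: if_splits)
  have Aj: "B j < A j"
    using pj cl_le[of "pmin (u p) A" j] unfolding v by (auto simp: pmin_def intro: less_le_trans)
  have ri: "B i \<le> v r i" using two_v[of q r i] vq e by (auto simp: le_max_iff_disj)
  have ij: "B j < B i" using s1 ile_eSuc[of "B j"] by (rule order.strict_trans1[rotated])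
  \<comment> \<open>Here \<open>r\<close> is not cut at \<open>j\<close>, since its entry at
    \<open>i\<close> is too large; thus \<open>u r j\<close> itself is small, which makes
    \<open>u q j\<close> large and forces the cut in \<open>q\<close>.\<close>
  have "\<not> v r j < pmin (u r) A j"
  proof
    assume "v r j < pmin (u r) A j"
    then have "pmin (u r) A i \<le> v r j" using cl_shrink(1)[OF dj, of "pmin (u r) A"] by (simp add: v)
    then have "v r i \<le> v r j" using cl_le[of "pmin (u r) A" i] by (simp add: v)
    then show False using ri ij rj by simp
  qed
  then have "u r j < A j" using rj Aj by (auto simp: pmin_def min_def split: if_splits)
  then have "A j \<le> u q j" using two_u[of q r j] e by (auto simp: le_max_iff_disj)
  then have "v q j < pmin (u q) A j" using qj Aj by (simp add: pmin_def)
  then have "pmin (u q) A k \<le> v q j" using cl_shrink(2)[OF dj, of "pmin (u q) A"] by (simp add: v)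
  then have "v q k \<le> v q j" using cl_le[of "pmin (u q) A" k] by (simp add: v)
  then show False using qk qj jk by simp
qed

text \<open>If the median fell below \<open>B i\<close>, two of the \<open>w\<close> entries at
  \<open>i\<close> would. By \<open>two_modular_core\<close> both were cut only in the second step.
  In each other coordinate one of the two elements reaches \<open>B\<close>, so together the two
  cuts contradict the closedness of \<open>B\<close>.\<close>

lemma cl_med_le_med_mstep: "cl (med (mstep u)) i \<le> med (mstep (mstep u)) i"
proof (rule ccontr)
  define v where "v = mstep u"
  define B where "B = cl (med v)"
  define w where "w = mstep v"
  obtain j k where d: "distinct [i, j, k]" using others[of i] by blast
  then have d': "distinct [i, k, j]" by auto
  have B: "B \<in> Clo" by (simp add: B_def)
  have two_v: "B l \<le> max (v a l) (v b l)" if "a \<noteq> b" for a b l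
    using cl_le[of "med v" l] med_le[OF that, of v l] by (simp add: B_def)
  have w: "w a = cl (pmin (v a) B)" for a by (simp add: w_def B_def mstep_conv)
  have sh: "eSuc (max (min (v a j) (B j)) (min (v a k) (B k))) < B i"
    if "w a i < B i" "B i \<le> v a i" for a
    using that unfolding w cl_eq[OF d] by (auto simp: pmin_def min_def split: if_splits)
  have one: False if pq: "p \<noteq> q" and wp: "w p i < B i" and vp: "B i \<le> v p i" and vq: "v q i < B i" for p q
  proof -
    obtain r where e: "distinct [p, q, r]" using third[OF pq] by blast
    have nj: "v p j \<le> B j"
      using two_modular_core[OF d e, of u] wp vp vq by (auto simp: v_def w_def B_def not_le[symmetric])
    have nk: "v p k \<le> B k"
      using two_modular_core[OF d' e, of u] wp vp vq by (auto simp: v_def w_def B_def not_le[symmetric])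
    \<comment> \<open>Intersecting with \<open>B\<close> changes \<open>v p\<close> in neither
      \<open>j\<close> nor \<open>k\<close>, so closedness of \<open>v p\<close> rules out the
      cut.\<close>
    have "v p i \<le> eSuc (max (v p j) (v p k))"
      using CloD[OF _ d, of "v p"] by (simp add: v_def mstep_def)
    then show False using sh[OF wp vp] nj nk vp by (simp add: min_absorb1)
  qed
  assume "\<not> cl (med (mstep u)) i \<le> med (mstep (mstep u)) i"
  then have "med w i < B i" by (simp add: v_def w_def B_def)
  then obtain p q where pq: "p \<noteq> q" and wp: "w p i < B i" and wq: "w q i < B i"
    using med_cases[of w i] by (meson order.strict_trans1)
  have vpq: "B i \<le> v p i" "B i \<le> v q i"
    using one[OF pq wp] one[OF pq[symmetric] wq] two_v[OF pq, of i]
    unfolding le_max_iff_disj by (meson not_less)+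
  have sp: "eSuc (max (min (v p j) (B j)) (min (v p k) (B k))) < B i" using sh[OF wp vpq(1)] .
  have sq: "eSuc (max (min (v q j) (B j)) (min (v q k) (B k))) < B i" using sh[OF wq vpq(2)] .
  have "B j \<le> max (v p j) (v q j)" "B k \<le> max (v p k) (v q k)" using two_v[OF pq] by auto
  then have "eSuc (max (B j) (B k)) < B i"
    using sp sq by (auto simp: max_def min_def split: if_splits intro: le_less_trans)
  then show False using CloD[OF B d] by simp
qed

text \<open>After two steps every entry is bounded by the closed median of the first step, hence by
  the current median; a further join adds nothing.\<close>

lemma mstep_3: "mstep (mstep (mstep u)) = mstep (mstep u)"
proof
  fix p
  define w where "w = mstep (mstep u)"
  have "w p i \<le> med w i" for i
  proof -
    have "w p i \<le> cl (med (mstep u)) i"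
      using cl_le[of "pmin (mstep u p) (cl (med (mstep u)))" i] by (simp add: w_def mstep_conv pmin_def)
    then show ?thesis using cl_med_le_med_mstep[of u i] by (simp add: w_def)
  qed
  then have "pmin (w p) (med w) = w p" by (simp add: pmin_def min_absorb1)
  moreover have "w p \<in> Clo" by (simp add: w_def mstep_def)
  ultimately have "mstep w p = w p" by (simp add: mstep_def Clo_def)
  then show "mstep (mstep (mstep u)) p = mstep (mstep u) p" by (simp add: w_def)
qed

definition tuple :: "(ix \<Rightarrow> trip) \<Rightarrow> trip \<times> trip \<times> trip" where
  "tuple u = (u finite_3.a\<^sub>1, u finite_3.a\<^sub>2, u finite_3.a\<^sub>3)"

text \<open>By absorption, joining \<open>x\<close> with the meet of \<open>y\<close> and
  \<open>z\<close> is joining it with the whole median, as the other two meets lie below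
  \<open>x\<close>.\<close>

lemma step1_tuple: "step1 cjoin pmax (tuple u) = tuple (mstep u)"
proof -
  have *: "pmin x (pmax y z) = pmin x (pmax (pmin x y) (pmax (pmin x z) (pmin y z)))"
    "pmin y (pmax x z) = pmin y (pmax (pmin x y) (pmax (pmin x z) (pmin y z)))"
    "pmin z (pmax x y) = pmin z (pmax (pmin x y) (pmax (pmin x z) (pmin y z)))" for x y z
    by (auto simp: pmin_def pmax_def min_def max_def fun_eq_iff)
  show ?thesis
    unfolding step1_def tuple_def mstep_def cjoin_def med_def prod.case
    by (simp only: *[where x="u finite_3.a\<^sub>1" and y="u finite_3.a\<^sub>2" and z="u finite_3.a\<^sub>3"])
qed

lemma two_modular_Clo: "two_modular Clo cjoin pmax"
  unfolding two_modular_def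
proof (intro ballI)
  fix x y z :: trip
  define u where "u p = (case p of finite_3.a\<^sub>1 \<Rightarrow> x | finite_3.a\<^sub>2 \<Rightarrow> y | finite_3.a\<^sub>3 \<Rightarrow> z)" for p
  have "(x, y, z) = tuple u" by (simp add: tuple_def u_def)
  then show "(step1 cjoin pmax ^^ 3) (x, y, z) = (step1 cjoin pmax ^^ 2) (x, y, z)"
    by (simp add: numeral_eq_Suc step1_tuple mstep_3)
qed

subsection \<open>Generation\<close>

text \<open>Element number \<open>v\<close> of chain \<open>p\<close>, seen in the lattice;
  \<open>v = 0\<close> gives the three generators, and \<open>v = \<infinity>\<close> gives the zero
  for each \<open>p\<close>.\<close>

definition ray :: "ix \<Rightarrow> enat \<Rightarrow> trip" where
  "ray p v = (\<lambda>i. if i = p then v else \<infinity>)"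

lemma ray_Clo: "ray p v \<in> Clo"
  by (rule CloI) (auto simp: ray_def)

lemma is_zero_Clo: "is_zero Clo cjoin (\<lambda>_. \<infinity>)"
  unfolding is_zero_def
proof (intro conjI ballI)
  show "(\<lambda>_. \<infinity>) \<in> Clo" by (rule CloI) simp
  show "cjoin (\<lambda>_. \<infinity>) x = x" if "x \<in> Clo" for x
    using that by (simp add: cjoin_def pmin_def Clo_def)
qed

lemma infinite_Clo: "infinite Clo"
proof
  assume "finite Clo"
  then have "finite (range (\<lambda>n. ray finite_3.a\<^sub>1 (enat n)))"
    by (rule rev_finite_subset) (auto simp: ray_Clo)
  moreover have "inj (\<lambda>n. ray finite_3.a\<^sub>1 (enat n))"
    by (auto simp: inj_def ray_def fun_eq_iff split: if_splits)
  ultimately show False using finite_imageD infinite_UNIV_nat by blast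
qed

text \<open>The pointwise minimum has entries 0 at \<open>r\<close>, \<open>n\<close> at
  \<open>q\<close> and \<infinity> at \<open>p\<close>; only the last is cut, to
  \<open>Suc n\<close>. The meet with \<open>ray p 0\<close> then erases the other two.\<close>

lemma ray_Suc:
  assumes d: "distinct [p, q, r]"
  shows "ray p (enat (Suc n)) = pmax (ray p 0) (cjoin (ray r 0) (ray q (enat n)))"
proof
  fix i
  have "distinct [p, q, r]" "distinct [q, p, r]" "distinct [r, p, q]" using d by auto
  note cl_eq[OF this(1)] cl_eq[OF this(2)] cl_eq[OF this(3)]
  moreover have "i = p \<or> i = q \<or> i = r" using compl_ix[OF d] by blast
  ultimately show "ray p (enat (Suc n)) i = pmax (ray p 0) (cjoin (ray r 0) (ray q (enat n))) i"
    using d by (auto simp: cjoin_def pmax_def pmin_def ray_def eSuc_enat)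
qed

lemma cjoin_rays:
  assumes "t \<in> Clo"
  shows "t = cjoin (cjoin (ray finite_3.a\<^sub>1 (t finite_3.a\<^sub>1)) (ray finite_3.a\<^sub>2 (t finite_3.a\<^sub>2))) (ray finite_3.a\<^sub>3 (t finite_3.a\<^sub>3))"
proof -
  have "pmin (pmin (ray finite_3.a\<^sub>1 (t finite_3.a\<^sub>1)) (ray finite_3.a\<^sub>2 (t finite_3.a\<^sub>2))) (ray finite_3.a\<^sub>3 (t finite_3.a\<^sub>3)) i = t i" for i
    by (cases i) (auto simp: pmin_def ray_def)
  then have "pmin (pmin (ray finite_3.a\<^sub>1 (t finite_3.a\<^sub>1)) (ray finite_3.a\<^sub>2 (t finite_3.a\<^sub>2))) (ray finite_3.a\<^sub>3 (t finite_3.a\<^sub>3)) = t" by blast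
  then show ?thesis using assms by (simp add: cjoin_def cl_pmin_cl Clo_def)
qed

lemma Clo_subset_generated:
  assumes S: "\<And>p. ray p 0 \<in> S" "\<And>x y. x \<in> S \<Longrightarrow> y \<in> S \<Longrightarrow> cjoin x y \<in> S \<and> pmax x y \<in> S"
  shows "Clo \<subseteq> S"
proof
  have fin: "ray p (enat n) \<in> S" for p n
  \<comment> \<open>All chains advance together: the next element of \<open>p\<close> comes from the
    current one of \<open>q\<close>.\<close>
  proof (induction n arbitrary: p)
    case 0
    then show ?case using S(1)[of p] by (simp add: zero_enat_def)
  next
    case (Suc n)
    obtain q r where "distinct [p, q, r]" using others[of p] by blast
    then show ?case using Suc S by (simp add: ray_Suc)
  qed
  have "ray p \<infinity> \<in> S" for p
  proof -
    have "ray p \<infinity> = pmax (ray finite_3.a\<^sub>1 0) (ray finite_3.a\<^sub>2 0)"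
      by (auto simp: ray_def pmax_def fun_eq_iff)
    then show ?thesis using S by simp
  qed
  with fin have "ray p v \<in> S" for p v by (cases v) auto
  then show "t \<in> S" if "t \<in> Clo" for t
    by (subst cjoin_rays[OF that]) (simp add: S(2))
qed

subsection \<open>Cappedness\<close>

text \<open>Repeatedly pass to a later index whose value is least among all values after the current
  index.\<close>

lemma infinite_subseq_mono:
  fixes s :: "nat \<Rightarrow> 'a::wellorder"
  shows "\<exists>g::nat \<Rightarrow> nat. strict_mono g \<and> (\<forall>m n. m \<le> n \<longrightarrow> s (g m) \<le> s (g n))"
proof -
  define P where "P a k \<longleftrightarrow> a < k \<and> (\<forall>l>a. s k \<le> s l)" for a k
  have ex: "\<exists>k. P a k" for a
  proof -
    define v where "v = (LEAST v. v \<in> s ` {a<..})"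
    have "v \<in> s ` {a<..}" unfolding v_def by (rule LeastI[of _ "s (Suc a)"]) auto
    moreover have "v \<le> s l" if "l > a" for l unfolding v_def by (rule Least_le) (use that in auto)
    ultimately show ?thesis unfolding P_def by auto
  qed
  define h where "h a = (SOME k. P a k)" for a
  have h: "P a (h a)" for a unfolding h_def by (rule someI_ex[OF ex])
  \<comment> \<open>The exponent starts at 1 because \<open>s 0\<close> need not be minimal.\<close>
  define g where "g n = (h ^^ Suc n) 0" for n
  have gS: "g (Suc n) = h (g n)" for n by (simp add: g_def)
  have sm: "strict_mono g" unfolding strict_mono_Suc_iff gS using h P_def by blast
  have "s (g n) \<le> s (g (Suc n))" for n
  proof (cases n)
    case 0
    have "0 < h (h 0)" using h[of 0] h[of "h 0"] unfolding P_def by simp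
    then show ?thesis using h[of 0] by (simp add: g_def 0 P_def)
  next
    case (Suc k)
    have "g k < g (Suc n)" using strict_monoD[OF sm, of k "Suc n"] Suc by simp
    then show ?thesis using h[of "g k"] unfolding P_def Suc gS by blast
  qed
  then have "m \<le> n \<Longrightarrow> s (g m) \<le> s (g n)" for m n
    using lift_Suc_mono_le[of "\<lambda>n. s (g n)"] by blast
  then show ?thesis using sm by auto
qed

lemma infinite_subseq_mono_finite:
  fixes s :: "nat \<Rightarrow> 'i \<Rightarrow> 'a::wellorder"
  assumes "finite I"
  shows "\<exists>g::nat \<Rightarrow> nat. strict_mono g \<and> (\<forall>i\<in>I. \<forall>m n. m \<le> n \<longrightarrow> s (g m) i \<le> s (g n) i)"
  using assms
proof (induction I)
  case empty
  show ?case by (rule exI[of _ "id :: nat \<Rightarrow> nat"]) (simp add: strict_mono_def)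
next
  case (insert i I)
  obtain g :: "nat \<Rightarrow> nat" where g: "strict_mono g" "\<forall>i\<in>I. \<forall>m n. m \<le> n \<longrightarrow> s (g m) i \<le> s (g n) i"
    using insert.IH by (elim exE conjE)
  obtain h :: "nat \<Rightarrow> nat" where h: "strict_mono h" "\<forall>m n. m \<le> n \<longrightarrow> s (g (h m)) i \<le> s (g (h n)) i"
    using infinite_subseq_mono[of "\<lambda>n. s (g n) i"] by (elim exE conjE)
  have "strict_mono (g \<circ> h)" using g(1) h(1) by (rule strict_mono_o)
  moreover have "s ((g \<circ> h) m) l \<le> s ((g \<circ> h) n) l" if "l \<in> insert i I" "m \<le> n" for l m n
    using that g(2) h by (auto simp: strict_mono_less_eq)
  ultimately show ?case by (intro exI[of _ "g \<circ> h"]) blast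
qed

text \<open>This is Dickson's lemma. Otherwise elements of \<open>D\<close> could be chosen forever
  with none above an earlier one, against the existence of a subsequence nondecreasing in every
  coordinate.\<close>

lemma finite_basis:
  fixes D :: "('i::finite \<Rightarrow> 'a::wellorder) set"
  shows "\<exists>\<Gamma>\<subseteq>D. finite \<Gamma> \<and> (\<forall>d\<in>D. \<exists>g\<in>\<Gamma>. g \<le> d)"
proof (rule ccontr)
  assume "\<not> ?thesis"
  then have "\<exists>d\<in>D. \<forall>g\<in>\<Gamma>. \<not> g \<le> d" if "finite \<Gamma>" "\<Gamma> \<subseteq> D" for \<Gamma>
    using that by meson
  then obtain c where c: "\<And>\<Gamma>. finite \<Gamma> \<Longrightarrow> \<Gamma> \<subseteq> D \<Longrightarrow> c \<Gamma> \<in> D \<and> (\<forall>g\<in>\<Gamma>. \<not> g \<le> c \<Gamma>)" by metis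
  \<comment> \<open>\<open>G n\<close> holds the first \<open>n\<close> choices; the next choice
    \<open>c (G n)\<close> lies above none of them.\<close>
  define G where "G n = ((\<lambda>X. insert (c X) X) ^^ n) {}" for n
  have GS: "G (Suc n) = insert (c (G n)) (G n)" for n by (simp add: G_def)
  have G: "finite (G n) \<and> G n \<subseteq> D" for n
  proof (induction n)
    case 0 show ?case by (simp add: G_def)
  next
    case (Suc n) then show ?case using c by (auto simp: GS)
  qed
  have mono: "m \<le> n \<Longrightarrow> G m \<subseteq> G n" for m n by (rule lift_Suc_mono_le) (auto simp: GS)
  obtain h :: "nat \<Rightarrow> nat" where h: "strict_mono h" "\<forall>i. \<forall>m n. m \<le> n \<longrightarrow> c (G (h m)) i \<le> c (G (h n)) i"
    using infinite_subseq_mono_finite[of UNIV "\<lambda>n. c (G n)"] by auto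
  have "h 0 < h 1" using h(1) by (simp add: strict_mono_less)
  then have "c (G (h 0)) \<in> G (h 1)" using mono[of "Suc (h 0)" "h 1"] by (auto simp: GS)
  moreover have "c (G (h 0)) \<le> c (G (h 1))" using h(2) by (simp add: le_fun_def)
  ultimately show False using c[of "G (h 1)"] G by meson
qed

section \<open>Down-sets in the square of the lattice\<close>

lemma le_iff_cjoin:
  assumes "a \<in> Clo"
  shows "cjoin a' a = a \<longleftrightarrow> a \<le> a'"
proof
  assume "cjoin a' a = a"
  then show "a \<le> a'" using cl_le[of "pmin a' a"] by (metis cjoin_def le_funI min.boundedE pmin_def)
next
  assume "a \<le> a'"
  then have "pmin a' a = a" by (auto simp: pmin_def le_fun_def min_absorb2)
  then show "cjoin a' a = a" using assms by (simp add: cjoin_def Clo_def)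
qed

text \<open>A pair of triples is a point with six coordinates, and the pointwise lower bounds from
  \<open>finite_basis\<close> are upper bounds in the reversed order.\<close>

lemma finite_basis_Clo:
  assumes "D \<subseteq> Clo \<times> Clo"
  shows "\<exists>\<Gamma>\<subseteq>D. finite \<Gamma> \<and> (\<forall>(a', b')\<in>D. \<exists>(a, b)\<in>\<Gamma>. cjoin a' a = a \<and> cjoin b' b = b)"
proof -
  define F :: "trip \<times> trip \<Rightarrow> ix + ix \<Rightarrow> enat" where "F d = case_sum (fst d) (snd d)" for d
  have F: "F c \<le> F d \<longleftrightarrow> fst c \<le> fst d \<and> snd c \<le> snd d" for c d
    by (auto simp: F_def le_fun_def split: sum.splits)
  obtain \<Gamma>' where "\<Gamma>' \<subseteq> F ` D" "finite \<Gamma>'" and *: "\<forall>d\<in>F ` D. \<exists>g\<in>\<Gamma>'. g \<le> d"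
    using finite_basis[of "F ` D"] by blast
  then obtain \<Gamma> where G: "\<Gamma> \<subseteq> D" "finite \<Gamma>" and "\<Gamma>' = F ` \<Gamma>"
    by (meson finite_subset_image)
  then have "\<forall>d\<in>D. \<exists>g\<in>\<Gamma>. F g \<le> F d" using * by blast
  moreover have "cjoin (fst d) (fst g) = fst g \<and> cjoin (snd d) (snd g) = snd g"
    if "g \<in> \<Gamma>" "F g \<le> F d" for d g
  proof -
    have "fst g \<in> Clo" "snd g \<in> Clo" using that(1) G(1) assms by auto
    then show ?thesis using that(2) by (simp add: F le_iff_cjoin)
  qed
  ultimately have "\<forall>d\<in>D. \<exists>g\<in>\<Gamma>. cjoin (fst d) (fst g) = fst g \<and> cjoin (snd d) (snd g) = snd g"
    by meson
  with G show ?thesis by (intro exI[of _ \<Gamma>]) (simp add: case_prod_unfold)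
qed

lemma capped_if_finite_basis:
  assumes "bi_ideal A ja za B jb zb I"
    and "\<Gamma> \<subseteq> I" "finite \<Gamma>" "\<forall>(a', b')\<in>I. \<exists>(a, b)\<in>\<Gamma>. ja a' a = a \<and> jb b' b = b"
  shows "capped A ja za B jb zb I"
proof -
  have I: "I \<subseteq> A \<times> B" "\<Gamma> \<union> (A \<times> {zb}) \<union> ({za} \<times> B) \<subseteq> I"
    using assms(1,2) unfolding bi_ideal_def by auto
  have down: "(a', b') \<in> I"
    if "(a, b) \<in> I" "a' \<in> A" "b' \<in> B" "ja a' a = a" "jb b' b = b" for a b a' b'
    using assms(1) that unfolding bi_ideal_def by meson
  have "I = {(a', b'). a' \<in> A \<and> b' \<in> B \<and>
      (\<exists>(a, b)\<in>\<Gamma> \<union> (A \<times> {zb}) \<union> ({za} \<times> B). ja a' a = a \<and> jb b' b = b)}" (is "I = ?R")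
  proof
    show "I \<subseteq> ?R" using I(1) assms(4) by blast
    show "?R \<subseteq> I" using I(2) down by auto
  qed
  then show ?thesis using assms I(1) unfolding capped_def by blast
qed

section \<open>Transport to the natural numbers\<close>

theorem theorem5p14:
  shows "\<exists>(K :: nat set) (j :: nat \<Rightarrow> nat \<Rightarrow> nat) (m :: nat \<Rightarrow> nat \<Rightarrow> nat) (z :: nat).
           lattice_on K j m \<and> is_zero K j z \<and> infinite K \<and>
           three_generated K j m \<and> two_modular K j m \<and>
           capped_tensor_product K j z K j z"
proof -
  \<comment> \<open>Triples of extended naturals are countable, so the lattice is copied into
    \<open>nat\<close> along the injection \<open>e\<close> with left inverse
    \<open>d\<close>.\<close>
  define e :: "trip \<Rightarrow> nat" where "e = to_nat"
  define d :: "nat \<Rightarrow> trip" where "d = from_nat"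
  have de [simp]: "d (e x) = x" for x by (simp add: e_def d_def)
  have e_inj [simp]: "e x = e y \<longleftrightarrow> x = y" for x y by (simp add: e_def)
  define K where "K = e ` Clo"
  define j where "j a b = e (cjoin (d a) (d b))" for a b
  define m where "m a b = e (pmax (d a) (d b))" for a b
  have j [simp]: "j (e x) (e y) = e (cjoin x y)" and m [simp]: "m (e x) (e y) = e (pmax x y)" for x y
    by (simp_all add: j_def m_def)
  have lat: "lattice_on K j m"
    using lattice_Clo by (auto simp: lattice_on_def K_def)
  have zero: "is_zero K j (e (\<lambda>_. \<infinity>))"
    using is_zero_Clo by (auto simp: is_zero_def K_def)
  have "inj e" by (simp add: inj_def)
  then have inf: "infinite K"
    using infinite_Clo finite_imageD inj_on_subset unfolding K_def by blast
  have gen: "three_generated K j m"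
  proof -
    define R where "R = {e (ray finite_3.a\<^sub>1 0), e (ray finite_3.a\<^sub>2 0), e (ray finite_3.a\<^sub>3 0)}"
    have RK: "R \<subseteq> K" by (auto simp: R_def K_def ray_Clo)
    then have "lat_gen j m R \<subseteq> K" using lat unfolding lat_gen_def lattice_on_def by blast
    moreover have "K \<subseteq> S" if S: "R \<subseteq> S" "\<forall>x\<in>S. \<forall>y\<in>S. j x y \<in> S \<and> m x y \<in> S" for S
    proof -
      have "Clo \<subseteq> e -` S"
      proof (rule Clo_subset_generated)
        show "ray p 0 \<in> e -` S" for p using S(1) by (cases p) (auto simp: R_def)
        show "cjoin x y \<in> e -` S \<and> pmax x y \<in> e -` S" if "x \<in> e -` S" "y \<in> e -` S" for x y
          using S(2) that by (metis j m vimage_eq)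
      qed
      then show ?thesis by (auto simp: K_def)
    qed
    then have "K \<subseteq> lat_gen j m R" unfolding lat_gen_def by blast
    ultimately have "K = lat_gen j m R" by blast
    then show ?thesis using RK unfolding three_generated_def R_def by blast
  qed
  have mod: "two_modular K j m"
  proof -
    define E where "E = map_prod e (map_prod e e)"
    have st: "step1 j m (E u) = E (step1 cjoin pmax u)" for u
      by (cases u) (simp add: E_def step1_def)
    have it: "(step1 j m ^^ n) (E u) = E ((step1 cjoin pmax ^^ n) u)" for n u
      by (induction n) (simp_all add: st)
    have E: "(e x, e y, e z) = E (x, y, z)" for x y z by (simp add: E_def)
    show ?thesis
      using two_modular_Clo unfolding two_modular_def K_def by (simp add: E it)
  qed
  have cap: "capped_tensor_product K j (e (\<lambda>_. \<infinity>)) K j (e (\<lambda>_. \<infinity>))"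
    unfolding capped_tensor_product_def
  proof (intro allI impI)
    fix I assume "compact_bi_ideal K j (e (\<lambda>_. \<infinity>)) K j (e (\<lambda>_. \<infinity>)) I"
    then have I: "bi_ideal K j (e (\<lambda>_. \<infinity>)) K j (e (\<lambda>_. \<infinity>)) I" by (simp add: compact_bi_ideal_def)
    define D where "D = {(a, b). (e a, e b) \<in> I}"
    have IK: "I \<subseteq> K \<times> K" using I by (simp add: bi_ideal_def)
    then have DC: "D \<subseteq> Clo \<times> Clo" and ID: "I = map_prod e e ` D"
      by (force simp: D_def K_def)+
    obtain \<Gamma> where G: "\<Gamma> \<subseteq> D" "finite \<Gamma>"
      and c: "\<forall>(a', b')\<in>D. \<exists>(a, b)\<in>\<Gamma>. cjoin a' a = a \<and> cjoin b' b = b"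
      using finite_basis_Clo[OF DC] by blast
    show "capped K j (e (\<lambda>_. \<infinity>)) K j (e (\<lambda>_. \<infinity>)) I"
    proof (rule capped_if_finite_basis[OF I])
      show "map_prod e e ` \<Gamma> \<subseteq> I" using G ID by blast
      show "finite (map_prod e e ` \<Gamma>)" using G by simp
      show "\<forall>(a', b')\<in>I. \<exists>(a, b)\<in>map_prod e e ` \<Gamma>. j a' a = a \<and> j b' b = b"
        using c unfolding ID case_prod_unfold by simp
    qed
  qed
  show ?thesis using lat zero inf gen mod cap by blast
qed

end
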